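(* The vertex operator algebra $L(\frac12,0)$ has an integral form generated by $2\omega$; that is, the vertex subring of $L(\frac12,0)$ generated by $2\omega$, where $\omega$ is the conformal vector of $L(\frac12,0)$, is an integral form of $L(\frac12,0)$.
   Context: $L(\frac12,0)$ is the simple Virasoro vertex operator algebra of central charge $\frac12$ over $\mathbb{C}$ (the irreducible lowest weight Virasoro module of central charge $\frac12$ and lowest weight $0$), with vacuum $\mathbf 1$ and conformal vector $\omega=L(-2)\mathbf 1$. Write $Y(u,x)=\sum_{m\in\mathbb{Z}}u_m x^{-m-1}$. A vertex subring of a vertex operator algebra $V$ is an additive subgroup containing $\mathbf 1$ and closed under all products $(u,v)\mapsto u_mv$, $m\in\mathbb{Z}$; the vertex subring generated by a subset is the smallest one containing it. An integral form of $V$ is a vertex subring $V_\mathbb{Z}\subseteq V$ which is the $\mathbb{Z}$-span of a $\mathbb{C}$-basis of $V$ and is compatible with the weight grading: $V_\mathbb{Z}=\coprod_{m\in\mathbb{Z}}V_{(m)}\cap V_\mathbb{Z}$, where $V_{(m)}$ is the $L(0)$-eigenspace with eigenvalue $m$. *)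

theory Defs
  imports Complex_Main "HOL-Library.Groups_Big_Fun"
begin

text \<open>The sum map from finitely supported families onto \<open>S\<close> is bijective: \<open>S\<close> is the internal
  direct sum of the \<open>A i\<close>.\<close>

definition internal_direct_sum :: "'v::ab_group_add set \<Rightarrow> ('i \<Rightarrow> 'v set) \<Rightarrow> bool" where
  "internal_direct_sum S A \<longleftrightarrow>
     bij_betw Sum_any {f. (\<forall>i. f i \<in> A i) \<and> finite {i. f i \<noteq> 0}} S"

text \<open>Modules for the Virasoro algebra on which the central element acts as the scalar \<open>c\<close>.\<close>

locale virasoro_module = vector_space scale
  for scale :: "complex \<Rightarrow> 'v::ab_group_add \<Rightarrow> 'v" +
  fixes L :: "int \<Rightarrow> 'v \<Rightarrow> 'v" and c :: complex
  assumes L_linear: "Vector_Spaces.linear scale scale (L n)"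
    and virasoro_relation:
      "L m (L n v) - L n (L m v) =
         scale (of_int (m - n)) (L (m + n) v) +
         (if m + n = 0 then scale (of_int (m ^ 3 - m) / 12 * c) v else 0)"
begin

definition virasoro_submodule :: "'v set \<Rightarrow> bool" where
  "virasoro_submodule W \<longleftrightarrow> subspace W \<and> (\<forall>n. \<forall>w\<in>W. L n w \<in> W)"

definition irreducible_module :: bool where
  "irreducible_module \<longleftrightarrow>
     (\<exists>v::'v. v \<noteq> 0) \<and> (\<forall>W. virasoro_submodule W \<longrightarrow> W = {0} \<or> W = UNIV)"

definition weight_space :: "complex \<Rightarrow> 'v set" where
  "weight_space h = {v. L 0 v = scale h v}"

definition lowest_weight_vector :: "complex \<Rightarrow> 'v \<Rightarrow> bool" where
  "lowest_weight_vector h v \<longleftrightarrow> v \<noteq> 0 \<and> v \<in> weight_space h \<and> (\<forall>n>0. L n v = 0)"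

definition lowest_weight_module :: "complex \<Rightarrow> bool" where
  "lowest_weight_module h \<longleftrightarrow>
     (\<exists>v. lowest_weight_vector h v \<and> virasoro_submodule hull {v} = UNIV)"

end

text \<open>\<open>mode u m v\<close> is \<open>u\<^sub>m v\<close>, the coefficient of \<open>x\<close> to the power \<open>-m-1\<close> in \<open>Y(u,x)v\<close>. The
  Jacobi identity is stated in components: \<open>l\<close>, \<open>m\<close>, \<open>n\<close> belong to the formal variables
  \<open>x\<^sub>0\<close>, \<open>x\<^sub>1\<close>, \<open>x\<^sub>2\<close>. By \<open>truncation\<close> both sums have finitely many nonzero terms, so
  \<open>Sum_any\<close> is the actual sum.\<close>

locale vertex_algebra = vector_space scale
  for scale :: "complex \<Rightarrow> 'v::ab_group_add \<Rightarrow> 'v" +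
  fixes mode :: "'v \<Rightarrow> int \<Rightarrow> 'v \<Rightarrow> 'v" and vac :: 'v
  assumes mode_linear_left: "Vector_Spaces.linear scale scale (\<lambda>u. mode u m v)"
    and mode_linear_right: "Vector_Spaces.linear scale scale (\<lambda>v. mode u m v)"
    and truncation: "\<exists>N. \<forall>m\<ge>N. mode u m v = 0"
    and vacuum: "mode vac m v = (if m = -1 then v else 0)"
    and creation_regular: "m \<ge> 0 \<Longrightarrow> mode u m vac = 0"
    and creation: "mode u (-1) vac = u"
    and jacobi:
      "Sum_any (\<lambda>i::nat. scale ((-1) ^ i * (of_int l gchoose i))
           (mode u (m + l - int i) (mode v (n + int i) w) -
            scale ((-1) powi l) (mode v (n + l - int i) (mode u (m + int i) w)))) =
       Sum_any (\<lambda>i::nat. scale (of_int m gchoose i)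
           (mode (mode u (l + int i) v) (m + n - int i) w))"
begin

definition vertex_subring :: "'v set \<Rightarrow> bool" where
  "vertex_subring S \<longleftrightarrow>
     0 \<in> S \<and> (\<forall>u\<in>S. \<forall>v\<in>S. u + v \<in> S) \<and> (\<forall>u\<in>S. - u \<in> S) \<and>
     vac \<in> S \<and> (\<forall>u\<in>S. \<forall>v\<in>S. \<forall>m. mode u m v \<in> S)"

definition generated_vertex_subring :: "'v set \<Rightarrow> 'v set" where
  "generated_vertex_subring A = vertex_subring hull A"

lemma vertex_subring_generated: "vertex_subring (generated_vertex_subring A)"
  unfolding generated_vertex_subring_def
  by (rule hull_in) (auto simp: vertex_subring_def)

lemma generated_vertex_subring_superset: "A \<subseteq> generated_vertex_subring A"
  unfolding generated_vertex_subring_def by (rule hull_subset)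

lemma generated_vertex_subring_minimal:
  "A \<subseteq> S \<Longrightarrow> vertex_subring S \<Longrightarrow> generated_vertex_subring A \<subseteq> S"
  unfolding generated_vertex_subring_def by (rule hull_minimal)

end

text \<open>With \<open>L(n) = \<omega>\<^bsub>n+1\<^esub>\<close>; the weight spaces are the \<open>L(0)\<close>-eigenspaces.\<close>

locale vertex_operator_algebra =
  vertex_algebra scale mode vac + virasoro_module scale "\<lambda>n. mode omega (n + 1)" c
  for scale :: "complex \<Rightarrow> 'v::ab_group_add \<Rightarrow> 'v"
    and mode :: "'v \<Rightarrow> int \<Rightarrow> 'v \<Rightarrow> 'v"
    and vac omega :: 'v
    and c :: complex +
  assumes L_minus_one_derivative:
      "mode (mode omega (-1 + 1) v) m w = scale (- of_int m) (mode v (m - 1) w)"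
    and grading: "internal_direct_sum UNIV (\<lambda>m::int. weight_space (of_int m))"
    and weight_spaces_finite_dim: "\<exists>B. finite B \<and> weight_space (of_int m) \<subseteq> span B"
    and weights_bounded_below: "\<exists>N::int. \<forall>m<N. weight_space (of_int m) = {0}"
begin

lemma omega_eq_L_minus_two_vac: "omega = mode omega (-2 + 1) vac"
  by (simp add: creation)

definition int_span :: "'v set \<Rightarrow> 'v set" where
  "int_span = module.span (\<lambda>n::int. scale (of_int n))"

sublocale int_module: module "\<lambda>n::int. scale (of_int n)"
  rewrites "module.span (\<lambda>n::int. scale (of_int n)) = int_span"
  by (unfold_locales; simp add: scale_right_distrib scale_left_distrib) (simp add: int_span_def)

definition integral_form :: "'v set \<Rightarrow> bool" where
  "integral_form S \<longleftrightarrow>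
     vertex_subring S \<and>
     (\<exists>B. independent B \<and> span B = UNIV \<and> S = int_span B) \<and>
     internal_direct_sum S (\<lambda>m::int. weight_space (of_int m) \<inter> S)"

end

text \<open>A vertex operator algebra satisfies these axioms iff it is isomorphic to \<open>L(c,0)\<close>: the
  Virasoro module determines \<open>\<omega>\<close>'s modes and, since \<open>\<omega>\<close> generates, the vertex operator map.
  The lowest weight vector is a multiple of \<open>vac\<close>, as the weight \<open>0\<close> space is a line.\<close>

locale simple_virasoro_voa = vertex_operator_algebra scale mode vac omega c
  for scale :: "complex \<Rightarrow> 'v::ab_group_add \<Rightarrow> 'v"
    and mode :: "'v \<Rightarrow> int \<Rightarrow> 'v \<Rightarrow> 'v"
    and vac omega :: 'v
    and c :: complex +
  assumes irreducible: "irreducible_module"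
    and lowest_weight_zero: "lowest_weight_module 0"

end

theory Submission imports Defs begin

text \<open>Put \<open>k = 2\<close>. As \<open>k\<^sup>2 c / 2\<close> is an integer, the operators \<open>k L(n)\<close> together with the identity span
  a Lie ring over the integers, because \<open>k\<^sup>2 c (m\<^sup>3 - m) / 12\<close> is then an integral multiple of
  \<open>(m\<^sup>3 - m) / 6\<close>. Hence the integer span \<open>S\<close> of the vectors \<open>k L(n\<^sub>1) \<dots> k L(n\<^sub>r) 1\<close> with all
  \<open>n\<^sub>i \<le> -2\<close> is stable under every \<open>k L(n)\<close>, and by the Jacobi identity it is the vertex subring
  generated by \<open>k \<omega>\<close>. Its weight \<open>0\<close> part is the integer span of \<open>1\<close>, so each functional
  \<open>v \<mapsto>\<close> (coefficient of \<open>1\<close> in \<open>k L(n\<^sub>1) \<dots> k L(n\<^sub>r) v\<close>) is integer valued on \<open>S\<close>. The common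
  kernel of these functionals is a proper submodule, hence zero. In each weight, finitely many of them
  therefore embed the weight space so that \<open>S\<close> is mapped into a lattice; this makes the weight piece
  of \<open>S\<close> free on a set that is linearly independent over the complex numbers.\<close>

section \<open>Integral binomials and subgroups of the integers\<close>

lemma Ints_gbinomial_of_int:
  "(of_int a :: 'a::field_char_0) gchoose k \<in> \<int>"
proof (cases "a \<ge> 0")
  case True
  then have "(of_int a :: 'a) = of_nat (nat a)" by simp
  then have "(of_int a :: 'a) gchoose k = of_nat (nat a choose k)"
    by (simp add: binomial_gbinomial)
  then show ?thesis by simp
next
  case False
  \<comment> \<open>For a negative upper entry, \<open>gbinomial_negated_upper\<close> replaces it,
    up to sign, by the natural number \<open>k - a - 1\<close>.\<close>
  then have "of_nat k - of_int a - 1 = (of_nat (nat (int k - a - 1)) :: 'a)" by simp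
  then have "(of_nat k - of_int a - 1) gchoose k = (of_nat (nat (int k - a - 1) choose k) :: 'a)"
    by (simp add: binomial_gbinomial)
  then show ?thesis
    by (subst gbinomial_negated_upper) simp
qed

lemma int_additive_subgroup_principal:
  fixes I :: "int set"
  assumes "0 \<in> I" and diff: "\<And>x y. x \<in> I \<Longrightarrow> y \<in> I \<Longrightarrow> x - y \<in> I"
  obtains d where "d \<in> I" and "\<And>x. x \<in> I \<Longrightarrow> d dvd x"
proof (cases "I \<subseteq> {0}")
  case True
  then show ?thesis using that \<open>0 \<in> I\<close> by auto
next
  case False
  have neg: "- x \<in> I" if "x \<in> I" for x
    using diff[OF \<open>0 \<in> I\<close> that] by simp
  have add: "x + y \<in> I" if "x \<in> I" "y \<in> I" for x y
    using diff[OF that(1) neg[OF that(2)]] by simp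
  have mult_nat: "int n * x \<in> I" if "x \<in> I" for n x
    by (induction n) (auto simp: distrib_right \<open>0 \<in> I\<close> intro: add that)
  have mult: "q * x \<in> I" if "x \<in> I" for q x
    using mult_nat[OF that, of "nat q"] mult_nat[OF neg[OF that], of "nat (-q)"]
    by (cases "q \<ge> 0") auto
  define n where "n = (LEAST n. n > 0 \<and> int n \<in> I)"
  from False obtain x where "x \<in> I" "x \<noteq> 0" by auto
  then have "nat \<bar>x\<bar> > 0 \<and> int (nat \<bar>x\<bar>) \<in> I"
    using neg by (auto simp: abs_if)
  then have n: "n > 0" "int n \<in> I"
    unfolding n_def by (metis (mono_tags, lifting) LeastI)+
  have "int n dvd y" if "y \<in> I" for y
  proof -
    have "y mod int n \<in> I"
      using diff[OF that mult[OF n(2), of "y div int n"]]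
      by (simp add: minus_div_mult_eq_mod)
    moreover have "0 \<le> y mod int n" "y mod int n < int n"
      using n(1) by simp_all
    ultimately have "\<not> nat (y mod int n) > 0"
      using not_less_Least[of "nat (y mod int n)" "\<lambda>n. n > 0 \<and> int n \<in> I"]
      unfolding n_def[symmetric] by auto
    with \<open>0 \<le> y mod int n\<close> show ?thesis by (simp add: dvd_eq_mod_eq_0)
  qed
  with n(2) that show ?thesis by blast
qed

section \<open>Internal direct sums\<close>

text \<open>Proved for modules because it serves both complex subspaces and integer
  submodules.\<close>

lemma (in module) subspace_Sum_any_image:
  assumes "\<And>i. subspace (A i)"
  shows "subspace (Sum_any ` {f. (\<forall>i. f i \<in> A i) \<and> finite {i. f i \<noteq> 0}})"
proof (rule subspaceI, goal_cases)
  case 1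
  show ?case
    by (rule image_eqI[of _ _ "\<lambda>_. 0"]) (auto intro: subspace_0 assms)
next
  case (2 x y)
  then obtain f g where f: "x = Sum_any f" "\<And>i. f i \<in> A i" "finite {i. f i \<noteq> 0}"
    and g: "y = Sum_any g" "\<And>i. g i \<in> A i" "finite {i. g i \<noteq> 0}" by auto
  have "finite {i. f i + g i \<noteq> 0}"
    by (rule finite_subset[of _ "{i. f i \<noteq> 0} \<union> {i. g i \<noteq> 0}"]) (auto simp: f g)
  then show ?case
    by (intro image_eqI[of _ _ "\<lambda>i. f i + g i"])
      (auto simp: f g Sum_any.distrib intro: subspace_add assms)
next
  case (3 r x)
  then obtain f where f: "x = Sum_any f" "\<And>i. f i \<in> A i" "finite {i. f i \<noteq> 0}" by auto
  have "finite {i. r *s f i \<noteq> 0}"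
    by (rule finite_subset[OF _ f(3)]) auto
  moreover have "Sum_any (\<lambda>i. r *s f i) = r *s Sum_any f"
    by (subst Sum_any.expand_superset[of "{i. f i \<noteq> 0}"])
      (auto simp: f scale_sum_right Sum_any.expand_set)
  ultimately show ?case
    by (intro image_eqI[of _ _ "\<lambda>i. r *s f i"]) (auto simp: f intro: subspace_scale assms)
qed

lemma Sum_any_image_single:
  assumes "x \<in> A j" and "\<And>i. 0 \<in> A i"
  shows "x \<in> Sum_any ` {f. (\<forall>i. f i \<in> A i) \<and> finite {i. f i \<noteq> 0}}"
  by (rule image_eqI[of _ _ "\<lambda>i. if i = j then x else 0"]) (auto simp: assms)

lemma internal_direct_sum_unique:
  assumes "internal_direct_sum S A" and "Sum_any f = Sum_any g"
    and "\<And>i. f i \<in> A i" "finite {i. f i \<noteq> 0}"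
    and "\<And>i. g i \<in> A i" "finite {i. g i \<noteq> 0}"
  shows "f = g"
  using assms unfolding internal_direct_sum_def bij_betw_def inj_on_def by blast

section \<open>Linear functionals, lattices and independence\<close>

context vector_space
begin

lemma linear_functional_simps:
  assumes "Vector_Spaces.linear scale (*) \<phi>"
  shows "\<phi> 0 = 0" "\<phi> (x + y) = \<phi> x + \<phi> y" "\<phi> (x - y) = \<phi> x - \<phi> y" "\<phi> (scale r x) = r * \<phi> x"
proof -
  interpret Vector_Spaces.linear scale "(*)" \<phi> by fact
  show "\<phi> 0 = 0" "\<phi> (x + y) = \<phi> x + \<phi> y" "\<phi> (x - y) = \<phi> x - \<phi> y" "\<phi> (scale r x) = r * \<phi> x"
    by (simp_all add: zero add diff scale)
qed

lemma subspace_functional_kernel: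
  assumes "Vector_Spaces.linear scale (*) \<phi>"
  shows "subspace {v. \<phi> v = 0}"
  by (rule subspaceI) (auto simp: linear_functional_simps[OF assms])

text \<open>A finite-dimensional space needs only finitely many functionals to cut out the common kernel
  of a family: each one added either changes nothing or loses a dimension.\<close>

lemma finite_subfamily_same_kernel:
  assumes "finite F" and lin: "\<And>\<phi>. \<phi> \<in> \<Phi> \<Longrightarrow> Vector_Spaces.linear scale (*) \<phi>"
  obtains \<Psi> where "finite \<Psi>" "\<Psi> \<subseteq> \<Phi>"
    "\<And>v \<phi>. v \<in> span F \<Longrightarrow> (\<And>\<psi>. \<psi> \<in> \<Psi> \<Longrightarrow> \<psi> v = 0) \<Longrightarrow> \<phi> \<in> \<Phi> \<Longrightarrow> \<phi> v = 0"
  using \<open>finite F\<close>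
proof (induction F arbitrary: thesis rule: finite_induct)
  case empty
  show ?case
    by (rule empty[of "{}"]) (auto simp: linear_functional_simps[OF lin])
next
  case (insert f F)
  obtain \<Psi> where \<Psi>: "finite \<Psi>" "\<Psi> \<subseteq> \<Phi>"
    and kill: "\<And>v \<phi>. v \<in> span F \<Longrightarrow> (\<And>\<psi>. \<psi> \<in> \<Psi> \<Longrightarrow> \<psi> v = 0) \<Longrightarrow> \<phi> \<in> \<Phi> \<Longrightarrow> \<phi> v = 0"
    using insert.IH by blast
  show ?case
  proof (cases "\<exists>w \<phi>. w \<in> span (insert f F) \<and> (\<forall>\<psi>\<in>\<Psi>. \<psi> w = 0) \<and> \<phi> \<in> \<Phi> \<and> \<phi> w \<noteq> 0")
    case False
    then show ?thesis using insert.prems[OF \<Psi>] by blast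
  next
    case True
    then obtain w \<chi> where w: "w \<in> span (insert f F)" "\<And>\<psi>. \<psi> \<in> \<Psi> \<Longrightarrow> \<psi> w = 0" "\<chi> \<in> \<Phi>" "\<chi> w \<noteq> 0"
      by blast
    from w(1) obtain a where a: "w - scale a f \<in> span F" by (auto simp: span_insert)
    \<comment> \<open>Otherwise \<open>w\<close> would lie in \<open>span F\<close>, and
      \<open>kill\<close> would give \<open>\<chi> w = 0\<close>.\<close>
    have "a \<noteq> 0" using a kill[of w \<chi>] w(2-4) by auto
    show ?thesis
    proof (rule insert.prems[of "insert \<chi> \<Psi>"])
      fix v \<phi> assume v: "v \<in> span (insert f F)" "\<And>\<psi>. \<psi> \<in> insert \<chi> \<Psi> \<Longrightarrow> \<psi> v = 0" and \<phi>: "\<phi> \<in> \<Phi>"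
      from v(1) obtain b where b: "v - scale b f \<in> span F" by (auto simp: span_insert)
      \<comment> \<open>Subtracting this multiple of \<open>w\<close> removes the
        \<open>f\<close>-component, so \<open>kill\<close> applies to the difference. As
        \<open>\<chi>\<close> vanishes on \<open>v\<close> but not on \<open>w\<close>, this forces
        \<open>b = 0\<close>.\<close>
      have "v - scale (b / a) w = (v - scale b f) - scale (b / a) (w - scale a f)"
        using \<open>a \<noteq> 0\<close> by (simp add: scale_right_diff_distrib)
      also have "\<dots> \<in> span F" by (intro span_diff span_scale a b)
      finally have in_span: "v - scale (b / a) w \<in> span F" .
      have "\<chi> (v - scale (b / a) w) = 0"
      proof (rule kill[OF in_span _ w(3)])
        fix \<psi> assume "\<psi> \<in> \<Psi>"
        then have "Vector_Spaces.linear scale (*) \<psi>" "\<psi> v = 0" "\<psi> w = 0"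
          using v(2) w(2) \<Psi>(2) lin by blast+
        then show "\<psi> (v - scale (b / a) w) = 0"
          by (simp add: linear_functional_simps)
      qed
      moreover have "\<chi> v = 0" using v(2) by blast
      ultimately have "b = 0"
        using w(3,4) \<open>a \<noteq> 0\<close> by (simp add: linear_functional_simps[OF lin])
      with b have "v \<in> span F" by simp
      then show "\<phi> v = 0" using kill v(2) \<phi> by blast
    qed (use \<Psi> w(3) in auto)
  qed
qed

text \<open>Induction on the number of functionals: a functional maps \<open>A\<close> onto a cyclic group, so \<open>A\<close> is
  its kernel in \<open>A\<close> plus the multiples of one vector.\<close>

lemma integral_basis_exists:
  assumes "finite \<Phi>" and "\<And>\<phi>. \<phi> \<in> \<Phi> \<Longrightarrow> Vector_Spaces.linear scale (*) \<phi>"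
    and "module.subspace (\<lambda>n::int. scale (of_int n)) A"
    and "\<And>\<phi> a. \<phi> \<in> \<Phi> \<Longrightarrow> a \<in> A \<Longrightarrow> \<phi> a \<in> \<int>"
    and "\<And>v. v \<in> span A \<Longrightarrow> (\<And>\<phi>. \<phi> \<in> \<Phi> \<Longrightarrow> \<phi> v = 0) \<Longrightarrow> v = 0"
  shows "\<exists>B. independent B \<and> A = module.span (\<lambda>n::int. scale (of_int n)) B"
  using assms
proof (induction \<Phi> arbitrary: A rule: finite_induct)
  interpret Z: module "\<lambda>n::int. scale (of_int n)"
    by unfold_locales (simp_all add: algebra_simps)
  case empty
  have "A = {0}" using empty.prems(4) span_base Z.subspace_0[OF empty.prems(2)] by auto
  then show ?case using independent_empty by (intro exI[of _ "{}"]) auto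
next
  interpret Z: module "\<lambda>n::int. scale (of_int n)"
    by unfold_locales (simp_all add: algebra_simps)
  case (insert \<phi> \<Phi>)
  have lin: "Vector_Spaces.linear scale (*) \<phi>" by (rule insert.prems) simp
  note [simp] = linear_functional_simps[OF lin]
  define A' where "A' = {a \<in> A. \<phi> a = 0}"
  have A'_sub: "A' = A \<inter> {v. \<phi> v = 0}" by (auto simp: A'_def)
  have span_A': "span A' \<subseteq> span A \<inter> {v. \<phi> v = 0}"
    by (rule span_minimal)
      (auto simp: A'_def intro: span_base subspace_inter subspace_functional_kernel lin)
  have "\<exists>B. independent B \<and> A' = Z.span B"
  proof (rule insert.IH)
    show "Z.subspace A'"
      unfolding A'_sub
      by (rule Z.subspace_inter[OF insert.prems(2)]) (rule Z.subspaceI, auto)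
    fix v assume "v \<in> span A'" "\<And>\<psi>. \<psi> \<in> \<Phi> \<Longrightarrow> \<psi> v = 0"
    then have "v \<in> span A" "\<And>\<psi>. \<psi> \<in> insert \<phi> \<Phi> \<Longrightarrow> \<psi> v = 0" using span_A' by auto
    then show "v = 0" by (rule insert.prems(4))
  qed (use insert.prems in \<open>auto simp: A'_def\<close>)
  then obtain B where B: "independent B" "A' = Z.span B" by blast
  define I where "I = {n::int. \<exists>a\<in>A. \<phi> a = of_int n}"
  have "0 \<in> I" using Z.subspace_0[OF insert.prems(2)] by (auto simp: I_def intro!: bexI[of _ 0])
  moreover have "x - y \<in> I" if "x \<in> I" "y \<in> I" for x y
    using that Z.subspace_diff[OF insert.prems(2)] unfolding I_def
    by (force simp: algebra_simps)
  ultimately obtain d where d: "d \<in> I" "\<And>n. n \<in> I \<Longrightarrow> d dvd n"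
    using int_additive_subgroup_principal by blast
  from d(1) obtain a where a: "a \<in> A" "\<phi> a = of_int d" by (auto simp: I_def)
  have reduce: "\<exists>q::int. x - scale (of_int q) a \<in> A'" if "x \<in> A" for x
  proof -
    have "\<phi> x \<in> \<int>" by (rule insert.prems(3)) (simp_all add: that)
    then obtain n where n: "\<phi> x = of_int n" by (rule Ints_cases)
    then have "d dvd n" using that by (intro d(2)) (auto simp: I_def)
    then obtain q where "n = d * q" ..
    then have "\<phi> (x - scale (of_int q) a) = 0" using a(2) n by (simp add: mult.commute)
    moreover have "x - scale (of_int q) a \<in> A"
      by (intro Z.subspace_diff[OF insert.prems(2)] Z.subspace_scale[OF insert.prems(2)] that a(1))
    ultimately show ?thesis by (auto simp: A'_def)
  qed
  show ?case
  \<comment> \<open>The split is on \<open>\<phi> a\<close> and not on \<open>d\<close>, since in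
    positive characteristic a nonzero \<open>d\<close> may become 0 in the field.\<close>
  proof (cases "\<phi> a = 0")
    case True
    have "A = A'"
    proof
      show "A \<subseteq> A'"
      proof
        fix x assume "x \<in> A"
        with reduce obtain q :: int where "x - scale (of_int q) a \<in> A'" by blast
        then have "\<phi> x = 0" by (simp add: A'_def True)
        then show "x \<in> A'" using \<open>x \<in> A\<close> by (simp add: A'_def)
      qed
    qed (auto simp: A'_def)
    then show ?thesis using B by blast
  next
    case False
    have "B \<subseteq> A'" using B(2) Z.span_superset by simp
    then have "span B \<subseteq> {v. \<phi> v = 0}" using span_A' span_mono by blast
    \<comment> \<open>\<open>\<phi>\<close> vanishes on the span of \<open>B\<close> over the whole
      field, so adjoining \<open>a\<close> keeps independence over the field and not merely over the
      integers.\<close>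
    then have "a \<notin> span B" using False by auto
    then have "independent (insert a B)" using B(1) by (rule independent_insertI)
    moreover have "A = Z.span (insert a B)"
    proof
      show "A \<subseteq> Z.span (insert a B)" using reduce B(2) by (auto simp: Z.span_insert)
      show "Z.span (insert a B) \<subseteq> A"
        using \<open>B \<subseteq> A'\<close> a(1) insert.prems(2) by (intro Z.span_minimal) (auto simp: A'_def)
    qed
    ultimately show ?thesis by blast
  qed
qed

text \<open>A linear relation is sorted by degree. Directness makes each homogeneous part vanish,
  and within one degree the independence of \<open>B i\<close> applies.\<close>

lemma independent_UN_direct_sum:
  assumes sum: "internal_direct_sum UNIV A" and sub: "\<And>i. subspace (A i)"
    and B: "\<And>i. B i \<subseteq> A i" "\<And>i. independent (B i)"
  shows "independent (\<Union>i. B i)"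
  unfolding independent_explicit_module
proof (intro allI impI)
  fix t u v assume t: "finite t" "t \<subseteq> (\<Union>i. B i)" "(\<Sum>w\<in>t. scale (u w) w) = 0" "v \<in> t"
  \<comment> \<open>A vector in two of the \<open>B i\<close> would have two decompositions unless
    it is 0, and an independent set omits 0. So each vector of \<open>t\<close> is counted in
    exactly one degree.\<close>
  have disj: "i = j" if "w \<in> B i" "w \<in> B j" for w i j
  proof (rule ccontr)
    assume "i \<noteq> j"
    have w: "w \<in> A i" "w \<in> A j" using that B(1) by auto
    have "(\<lambda>l. if l = i then w else 0) = (\<lambda>l. if l = j then w else 0)"
      by (rule internal_direct_sum_unique[OF sum])
        (use w in \<open>auto simp: subspace_0[OF sub]\<close>)
    then have "w = 0" using \<open>i \<noteq> j\<close> by (auto dest: fun_cong[of _ _ i])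
    then show False using that B(2) dependent_zero by blast
  qed
  define f where "f i = (\<Sum>w\<in>t \<inter> B i. scale (u w) w)" for i
  have "\<forall>w\<in>t. \<exists>i. w \<in> B i" using t(2) by auto
  then obtain d where d: "\<And>w. w \<in> t \<Longrightarrow> w \<in> B (d w)" by metis
  have tB: "t \<inter> B i = {w \<in> t. d w = i}" for i using d disj by auto
  have supp: "{i. f i \<noteq> 0} \<subseteq> d ` t"
  proof
    fix i assume "i \<in> {i. f i \<noteq> 0}"
    then have "(\<Sum>w\<in>t \<inter> B i. scale (u w) w) \<noteq> 0" by (simp add: f_def)
    then obtain w where "w \<in> t \<inter> B i" by (rule sum.not_neutral_contains_not_neutral)
    then show "i \<in> d ` t" by (auto simp: tB)
  qed
  have "Sum_any f = sum f (d ` t)"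
    by (rule Sum_any.expand_superset) (use supp t(1) in auto)
  also have "\<dots> = (\<Sum>w\<in>t. scale (u w) w)"
    unfolding f_def tB using t(1) by (rule sum.image_gen[symmetric])
  finally have "Sum_any f = Sum_any (\<lambda>_. 0)" using t(3) by simp
  then have "f = (\<lambda>_. 0)"
  proof (rule internal_direct_sum_unique[OF sum])
    show "f i \<in> A i" for i
      unfolding f_def using B(1) by (blast intro: subspace_sum sub subspace_scale)
    show "finite {i. f i \<noteq> 0}" using supp t(1) finite_subset by blast
  qed (auto simp: subspace_0[OF sub])
  then have "(\<Sum>w\<in>t \<inter> B (d v). scale (u w) w) = 0" by (metis f_def)
  then show "u v = 0"
    using independentD[OF B(2), of "t \<inter> B (d v)" "d v" u v] t(1,4) d by auto
qed

text \<open>Adjoining \<open>v\<close> to a maximal independent subset of \<open>M\<close> leaves it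
  independent, so the value 1 on \<open>v\<close> and 0 on that subset can be prescribed and
  extended linearly.\<close>

lemma functional_separating_vector:
  assumes "v \<notin> span M"
  obtains \<pi> where "Vector_Spaces.linear scale (*) \<pi>" "\<pi> v = 1" "\<And>w. w \<in> M \<Longrightarrow> \<pi> w = 0"
proof -
  interpret vs: vector_space_pair scale "(*) :: 'a \<Rightarrow> 'a \<Rightarrow> 'a"
    by unfold_locales (simp_all add: algebra_simps)
  obtain B where B: "B \<subseteq> M" "independent B" "M \<subseteq> span B"
    using maximal_independent_subset .
  have "v \<notin> span B" using assms span_mono[OF B(1)] by auto
  then have "independent (insert v B)" using B(2) by (rule independent_insertI)
  then obtain \<pi> where \<pi>: "Vector_Spaces.linear scale (*) \<pi>"
    "\<And>w. w \<in> insert v B \<Longrightarrow> \<pi> w = (if w = v then 1 else 0)"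
    using vs.linear_independent_extend[of "insert v B" "\<lambda>w. if w = v then 1 else 0"] by blast
  have "v \<notin> B" using \<open>v \<notin> span B\<close> span_base by blast
  have "span B \<subseteq> {w. \<pi> w = 0}"
  proof (rule span_minimal)
    show "B \<subseteq> {w. \<pi> w = 0}" using \<pi>(2) \<open>v \<notin> B\<close> by auto
  qed (rule subspace_functional_kernel[OF \<pi>(1)])
  then have "\<pi> w = 0" if "w \<in> M" for w using that B(3) by auto
  with \<pi> show ?thesis by (intro that[of \<pi>]) auto
qed

end

section \<open>Linearity of modes and the iterate formula\<close>

context vertex_algebra
begin

lemma mode_simps:
  "mode (u + u') m v = mode u m v + mode u' m v" "mode (- u) m v = - mode u m v" "mode 0 m v = 0"
  "mode (scale r u) m v = scale r (mode u m v)"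
  "mode u m (v + v') = mode u m v + mode u m v'" "mode u m (- v) = - mode u m v" "mode u m 0 = 0"
  "mode u m (scale r v) = scale r (mode u m v)"
proof -
  interpret l: Vector_Spaces.linear scale scale "\<lambda>u. mode u m v" for v by (rule mode_linear_left)
  interpret r: Vector_Spaces.linear scale scale "mode u m" for u using mode_linear_right .
  show "mode (u + u') m v = mode u m v + mode u' m v" "mode (- u) m v = - mode u m v" "mode 0 m v = 0"
    "mode (scale r u) m v = scale r (mode u m v)"
    by (rule l.add l.neg l.zero l.scale)+
  show "mode u m (v + v') = mode u m v + mode u m v'" "mode u m (- v) = - mode u m v" "mode u m 0 = 0"
    "mode u m (scale r v) = scale r (mode u m v)"
    by (rule r.add r.neg r.zero r.scale)+
qed

text \<open>The Jacobi identity at \<open>m = 0\<close> is the iterate formula: it expresses the modes of \<open>u\<^sub>l v\<close> as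
  integral combinations of products of modes of \<open>u\<close> and \<open>v\<close>.\<close>

lemma mode_mode_mem:
  assumes Z: "module.subspace (\<lambda>n::int. scale (of_int n)) S"
    and u: "\<And>m w. w \<in> S \<Longrightarrow> mode u m w \<in> S" and v: "\<And>m w. w \<in> S \<Longrightarrow> mode v m w \<in> S"
    and "w \<in> S"
  shows "mode (mode u l v) n w \<in> S"
proof -
  interpret Z: module "\<lambda>n::int. scale (of_int n)"
    by unfold_locales (simp_all add: algebra_simps)
  have Ints: "scale r x \<in> S" if "r \<in> \<int>" "x \<in> S" for r x
    using that Z.subspace_scale[OF Z] by (auto elim: Ints_cases)
  \<comment> \<open>Prepares the right-hand side of \<open>jacobi\<close> at \<open>m = 0\<close>,
    where \<open>0 gchoose i\<close> leaves only the term \<open>i = 0\<close>.\<close>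
  have "mode (mode u l v) n w =
      Sum_any (\<lambda>i::nat. if i = 0 then mode (mode u (l + int i) v) (0 + n - int i) w else 0)"
    by simp
  also have "\<dots> = Sum_any (\<lambda>i::nat. scale (of_int 0 gchoose i)
           (mode (mode u (l + int i) v) (0 + n - int i) w))"
    by (rule Sum_any.cong) (simp add: gbinomial_0_left)
  also have "\<dots> = Sum_any (\<lambda>i::nat. scale ((-1) ^ i * (of_int l gchoose i))
           (mode u (0 + l - int i) (mode v (n + int i) w) -
            scale ((-1) powi l) (mode v (n + l - int i) (mode u (0 + int i) w))))"
    by (rule jacobi[symmetric])
  also have "\<dots> \<in> S"
    \<comment> \<open>A \<open>sum\<close> over the support is checked termwise; its default value 0
      on an infinite set would lie in \<open>S\<close> too.\<close>
    unfolding Sum_any.expand_set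
  proof (rule Z.subspace_sum[OF Z])
    fix i :: nat
    have "(-1 :: complex) powi l \<in> \<int>"
      by (auto simp: power_int_def)
    then show "scale ((-1) ^ i * (of_int l gchoose i))
           (mode u (0 + l - int i) (mode v (n + int i) w) -
            scale ((-1) powi l) (mode v (n + l - int i) (mode u (0 + int i) w))) \<in> S"
      by (intro Ints Z.subspace_diff[OF Z] u v \<open>w \<in> S\<close>) (simp_all add: Ints_gbinomial_of_int)
  qed
  finally show ?thesis .
qed

end

section \<open>Rescaled Virasoro operators and their monomials\<close>

context vertex_operator_algebra
begin

definition scaled_L :: "int \<Rightarrow> int \<Rightarrow> 'v \<Rightarrow> 'v" where
  "scaled_L k n v = scale (of_int k) (mode omega (n + 1) v)"

text \<open>The indices are unordered, so these vectors are a spanning set and in general no basis;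
  in return, prepending any index at most -2 stays inside the set. Index -1 is left out because it
  kills \<open>vac\<close>.\<close>

inductive_set monomials :: "int \<Rightarrow> 'v set" for k where
  vac: "vac \<in> monomials k"
| step: "w \<in> monomials k \<Longrightarrow> n \<le> -2 \<Longrightarrow> scaled_L k n w \<in> monomials k"

lemma scaled_L_simps [simp]:
  "scaled_L k n 0 = 0" "scaled_L k n (u + v) = scaled_L k n u + scaled_L k n v"
  "scaled_L k n (scale r v) = scale r (scaled_L k n v)"
  by (simp_all add: scaled_L_def mode_simps scale_right_distrib scale_left_commute)

lemma scaled_L_vac: "n \<ge> -1 \<Longrightarrow> scaled_L k n vac = 0"
  by (simp add: scaled_L_def creation_regular)

text \<open>In the bracket term one factor \<open>k\<close> is absorbed into
  \<open>scaled_L k (m + n)\<close>. The central coefficient is \<open>k ^ 2 * c / 2\<close> times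
  \<open>(m ^ 3 - m) / 6\<close>, a product of two integers; only its integrality matters later,
  hence the existential \<open>j\<close>.\<close>

lemma scaled_L_commute:
  assumes "of_int k ^ 2 * c / 2 \<in> \<int>"
  shows "\<exists>j. scaled_L k m (scaled_L k n v) =
    scaled_L k n (scaled_L k m v) + scale (of_int (k * (m - n))) (scaled_L k (m + n) v) + scale (of_int j) v"
proof -
  obtain r where r: "of_int k ^ 2 * c / 2 = of_int r" using assms by (auto elim: Ints_cases)
  have "6 dvd m ^ 3 - m"
  proof -
    have "m mod 6 \<in> {0, 1, 2, 3, 4, 5}" by auto
    then have "(m ^ 3 - m) mod 6 = 0"
      by (subst mod_diff_eq[symmetric], subst power_mod[symmetric]) auto
    then show ?thesis by (rule mod_0_imp_dvd)
  qed
  then obtain q where q: "m ^ 3 - m = 6 * q" by (auto simp: dvd_def)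
  let ?j = "if m + n = 0 then r * q else 0"
  have j: "of_int k ^ 2 * (of_int (m ^ 3 - m) / 12 * c) = of_int (r * q)"
    using r by (simp add: q)
  have eq: "mode omega (m + 1) (mode omega (n + 1) v) = mode omega (n + 1) (mode omega (m + 1) v) +
      (scale (of_int (m - n)) (mode omega (m + n + 1) v) +
         (if m + n = 0 then scale (of_int (m ^ 3 - m) / 12 * c) v else 0))"
    using virasoro_relation[of m n v] by (metis add.commute diff_add_cancel)
  have "scaled_L k m (scaled_L k n v) =
    scale (of_int k ^ 2) (mode omega (m + 1) (mode omega (n + 1) v))"
    by (simp add: scaled_L_def mode_simps power2_eq_square)
  also have "\<dots> = scaled_L k n (scaled_L k m v) + scale (of_int (k * (m - n))) (scaled_L k (m + n) v)
    + scale (of_int ?j) v"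
    unfolding eq scale_right_distrib scaled_L_def mode_simps
    using j by (auto simp: power2_eq_square algebra_simps)
  finally show ?thesis by blast
qed

lemma scaled_L_weight:
  assumes "v \<in> weight_space (of_int m)"
  shows "scaled_L k n v \<in> weight_space (of_int (m - n))"
proof -
  have 0: "mode omega (0 + 1) v = scale (of_int m) v"
    using assms by (simp add: weight_space_def)
  have "mode omega (0 + 1) (mode omega (n + 1) v) = scale (of_int (m - n)) (mode omega (n + 1) v)"
    \<comment> \<open>With first index 0 the central term drops out, since
      \<open>0 ^ 3 - 0 = 0\<close>.\<close>
    using virasoro_relation[of 0 n v] unfolding 0 mode_simps
    by (simp add: algebra_simps)
  then show ?thesis
    unfolding weight_space_def scaled_L_def mem_Collect_eq mode_simps by (simp add: mult.commute)
qed

lemma subspace_weight_space: "subspace (weight_space h)"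
  by (rule subspaceI) (auto simp: weight_space_def mode_simps scale_right_distrib scale_left_commute)

lemma vac_weight: "vac \<in> weight_space (of_int 0)"
  by (simp add: weight_space_def creation_regular)

text \<open>Each factor raises the weight by at least 2, so only the empty product has weight 0.
  This is what later separates \<open>vac\<close> from the other monomials.\<close>

lemma monomials_weight:
  assumes "w \<in> monomials k"
  shows "\<exists>m\<ge>0. w \<in> weight_space (of_int m) \<and> (m = 0 \<longrightarrow> w = vac)"
  using assms
proof induction
  case vac
  then show ?case using vac_weight by blast
next
  case (step w n)
  then obtain m where "m \<ge> 0" "w \<in> weight_space (of_int m)" by blast
  then show ?case using scaled_L_weight[of w m k n] step.hyps(2) by (intro exI[of _ "m - n"]) auto
qed

lemma int_subspace_if_subspace: "subspace W \<Longrightarrow> int_module.subspace W"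
  by (auto intro: int_module.subspaceI subspace_0 subspace_add subspace_scale)

lemma int_span_subset_span: "int_span M \<subseteq> span M"
  by (intro int_module.span_minimal span_superset int_subspace_if_subspace subspace_span)

lemma scaled_L_int_span:
  assumes "\<And>w. w \<in> M \<Longrightarrow> scaled_L k n w \<in> int_span M'" and "w \<in> int_span M"
  shows "scaled_L k n w \<in> int_span M'"
  using assms(2)
proof (rule int_module.span_induct)
  show "int_module.subspace {w. scaled_L k n w \<in> int_span M'}"
    by (rule int_module.subspaceI)
      (auto intro: int_module.span_zero int_module.span_add int_module.span_scale)
qed (rule assms(1))

text \<open>The operator is commuted past the leftmost factor; the induction hypothesis, taken for
  all indices, handles both \<open>n\<close> and \<open>n + p\<close>. At \<open>vac\<close>, the
  index either gives a new monomial or kills it.\<close>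

lemma scaled_L_monomials:
  assumes k: "of_int k ^ 2 * c / 2 \<in> \<int>" and "w \<in> monomials k"
  shows "scaled_L k n w \<in> int_span (monomials k)"
  using assms(2)
proof (induction arbitrary: n)
  case vac
  show ?case
  proof (cases "n \<le> -2")
    case True
    then show ?thesis by (intro int_module.span_base monomials.intros)
  next
    case False
    then show ?thesis by (simp add: scaled_L_vac int_module.span_zero)
  qed
next
  case (step w p)
  obtain j where j: "scaled_L k n (scaled_L k p w) = scaled_L k p (scaled_L k n w) +
      scale (of_int (k * (n - p))) (scaled_L k (n + p) w) + scale (of_int j) w"
    using scaled_L_commute[OF k] by blast
  have "scaled_L k p (scaled_L k n w) \<in> int_span (monomials k)"
    by (rule scaled_L_int_span[OF _ step.IH])
      (use step.hyps(2) in \<open>auto intro: int_module.span_base monomials.step\<close>)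
  then show ?case
    unfolding j
    by (intro int_module.span_add int_module.span_scale step.IH) (auto intro: int_module.span_base step.hyps)
qed

lemma scaled_L_closed:
  assumes "of_int k ^ 2 * c / 2 \<in> \<int>" and "w \<in> int_span (monomials k)"
  shows "scaled_L k n w \<in> int_span (monomials k)"
  using scaled_L_int_span[OF scaled_L_monomials[OF assms(1)] assms(2)] .

section \<open>The generated vertex subring and its weight pieces\<close>

lemma generated_eq_int_span_monomials:
  assumes k: "of_int k ^ 2 * c / 2 \<in> \<int>"
  shows "generated_vertex_subring {scale (of_int k) omega} = int_span (monomials k)"
    (is "?G = ?S")
proof
  have G: "vertex_subring ?G" "scale (of_int k) omega \<in> ?G"
    using vertex_subring_generated generated_vertex_subring_superset by auto
  have G_scale: "scale (of_int n) u \<in> ?G" if "u \<in> ?G" for n u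
  proof -
    have nat: "scale (of_nat i) u \<in> ?G" for i
      by (induction i) (use that G(1) in \<open>auto simp: vertex_subring_def scale_left_distrib\<close>)
    show ?thesis
      by (cases n rule: int_cases2) (use nat G(1) in \<open>auto simp: vertex_subring_def\<close>)
  qed
  then have "int_module.subspace ?G"
    using G(1) by (auto simp: vertex_subring_def intro: int_module.subspaceI)
  moreover have "w \<in> ?G" if "w \<in> monomials k" for w
    using that
  proof induction
    case (step w n)
    then have "mode (scale (of_int k) omega) (n + 1) w \<in> ?G"
      using G unfolding vertex_subring_def by blast
    then show ?case by (simp add: scaled_L_def mode_simps)
  qed (use G(1) in \<open>simp add: vertex_subring_def\<close>)
  ultimately show "?S \<subseteq> ?G" by (intro int_module.span_minimal subsetI)
  \<comment> \<open>Closure of \<open>?S\<close> under products is not visible directly. The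
    elements of \<open>?S\<close> all of whose modes preserve \<open>?S\<close> form a subring by
    \<open>mode_mode_mem\<close>, and minimality of \<open>?G\<close> then suffices.\<close>
  define T where "T = {u \<in> ?S. \<forall>m. \<forall>w\<in>?S. mode u m w \<in> ?S}"
  have vac: "vac \<in> ?S" by (intro int_module.span_base monomials.vac)
  have "vertex_subring T"
    unfolding vertex_subring_def T_def
    using mode_mode_mem[of ?S]
    by (auto simp: mode_simps vacuum vac intro: int_module.span_zero int_module.span_add int_module.span_neg)
  moreover have "scale (of_int k) omega \<in> T"
  proof -
    have "mode (scale (of_int k) omega) m w = scaled_L k (m - 1) w" for m w
      by (simp add: scaled_L_def mode_simps)
    \<comment> \<open>Mode -1 corresponds to index -2 of \<open>scaled_L\<close>, and
      \<open>creation\<close> returns the vector itself.\<close>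
    moreover from this have "scale (of_int k) omega = scaled_L k (-2) vac"
      using creation[of "scale (of_int k) omega"] by simp
    ultimately show ?thesis by (simp add: T_def scaled_L_closed[OF k] vac)
  qed
  ultimately have "?G \<subseteq> T" by (intro generated_vertex_subring_minimal) auto
  then show "?G \<subseteq> ?S" by (auto simp: T_def)
qed

text \<open>Uniqueness is inherited from the grading of the whole space. For existence, the sums of
  homogeneous elements form an integer submodule, so it is enough that each monomial is
  homogeneous.\<close>

lemma direct_sum_int_span_monomials:
  "internal_direct_sum (int_span (monomials k)) (\<lambda>m::int. weight_space (of_int m) \<inter> int_span (monomials k))"
proof -
  let ?S = "int_span (monomials k)"
  let ?F = "{f. (\<forall>m::int. f m \<in> weight_space (of_int m) \<inter> ?S) \<and> finite {m. f m \<noteq> 0}}"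
  have "inj_on Sum_any ?F"
    by (rule inj_onI, rule internal_direct_sum_unique[OF grading]) auto
  moreover have "Sum_any ` ?F \<subseteq> ?S"
    by (auto simp: Sum_any.expand_set intro: int_module.span_sum)
  moreover have "?S \<subseteq> Sum_any ` ?F"
  proof (rule int_module.span_minimal)
    show "monomials k \<subseteq> Sum_any ` ?F"
    proof
      fix w assume "w \<in> monomials k"
      moreover from this obtain m where "w \<in> weight_space (of_int m)"
        using monomials_weight by blast
      ultimately show "w \<in> Sum_any ` ?F"
        by (intro Sum_any_image_single[of _ _ m])
          (auto intro: int_module.span_base int_module.span_zero subspace_0 subspace_weight_space)
    qed
    show "int_module.subspace (Sum_any ` ?F)"
      by (intro int_module.subspace_Sum_any_image int_module.subspace_inter
          int_subspace_if_subspace subspace_weight_space int_module.subspace_span)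
  qed
  ultimately show ?thesis by (auto simp: internal_direct_sum_def bij_betw_def)
qed

lemma vac_notin_span_monomials:
  assumes "vac \<noteq> 0"
  shows "vac \<notin> span (monomials k - {vac})"
proof
  \<comment> \<open>All monomials other than \<open>vac\<close> have nonzero weight, so their span
    lies in the sum of these spaces, whereas \<open>vac\<close> has a nonzero component in weight
    0.\<close>
  let ?A = "\<lambda>m::int. if m = 0 then {0} else weight_space (of_int m)"
  let ?F = "{f. (\<forall>m. f m \<in> ?A m) \<and> finite {m. f m \<noteq> 0}}"
  have "span (monomials k - {vac}) \<subseteq> Sum_any ` ?F"
  proof (rule span_minimal)
    show "monomials k - {vac} \<subseteq> Sum_any ` ?F"
    proof
      fix w assume "w \<in> monomials k - {vac}"
      then obtain m where "w \<in> weight_space (of_int m)" "m \<noteq> 0"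
        using monomials_weight by blast
      then show "w \<in> Sum_any ` ?F"
        by (intro Sum_any_image_single[of _ _ m]) (auto intro: subspace_0 subspace_weight_space)
    qed
    show "subspace (Sum_any ` ?F)"
      by (intro subspace_Sum_any_image) (simp add: subspace_weight_space)
  qed
  moreover assume "vac \<in> span (monomials k - {vac})"
  ultimately obtain f where f: "vac = Sum_any f" "\<And>m. f m \<in> ?A m" "finite {m. f m \<noteq> 0}"
    by blast
  have "f = (\<lambda>m. if m = 0 then vac else 0)"
  proof (rule internal_direct_sum_unique[OF grading])
    fix m :: int
    show "f m \<in> weight_space (of_int m)"
      using f(2)[of m] subspace_0[OF subspace_weight_space] by (auto split: if_splits)
  qed (use f vac_weight in \<open>auto intro: subspace_0 subspace_weight_space\<close>)
  with f(2)[of 0] assms show False by simp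
qed

end

section \<open>Integral functionals and bases in the irreducible case\<close>

context simple_virasoro_voa
begin

lemma vac_nonzero: "vac \<noteq> 0"
proof -
  obtain v :: 'v where "v \<noteq> 0" using irreducible by (auto simp: irreducible_module_def)
  then show ?thesis using vacuum[of "-1" v] by (auto simp: mode_simps)
qed

lemma integral_functionals:
  assumes k: "of_int k ^ 2 * c / 2 \<in> \<int>" "k \<noteq> 0"
  obtains \<Phi> where
    "\<And>\<phi>. \<phi> \<in> \<Phi> \<Longrightarrow> Vector_Spaces.linear scale (*) \<phi>"
    "\<And>\<phi> a. \<phi> \<in> \<Phi> \<Longrightarrow> a \<in> int_span (monomials k) \<Longrightarrow> \<phi> a \<in> \<int>"
    "\<And>v. (\<And>\<phi>. \<phi> \<in> \<Phi> \<Longrightarrow> \<phi> v = 0) \<Longrightarrow> v = 0"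
proof -
  let ?S = "int_span (monomials k)"
  \<comment> \<open>\<open>\<pi>\<close> reads off the coefficient of \<open>vac\<close>; its values
    on monomials are 0 and 1, hence integral on \<open>?S\<close>.\<close>
  obtain \<pi> where lin: "Vector_Spaces.linear scale (*) \<pi>" and \<pi>: "\<pi> vac = 1"
    "\<And>w. w \<in> monomials k - {vac} \<Longrightarrow> \<pi> w = 0"
    using functional_separating_vector vac_notin_span_monomials[OF vac_nonzero] by metis
  note [simp] = linear_functional_simps[OF lin]
  have \<pi>_Ints: "\<pi> a \<in> \<int>" if "a \<in> ?S" for a
    using that
  proof (rule int_module.span_induct)
    show "int_module.subspace {a. \<pi> a \<in> \<int>}" by (rule int_module.subspaceI) auto
    fix w assume "w \<in> monomials k"
    then show "\<pi> w \<in> \<int>" using \<pi> by (cases "w = vac") auto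
  qed
  \<comment> \<open>The words \<open>ns\<close> use arbitrary integer indices, which makes the
    common kernel stable under every \<open>scaled_L k n\<close>: \<open>foldr\<close> applies the
    last entry first, so acting by \<open>scaled_L k n\<close> beforehand amounts to appending
    \<open>n\<close>.\<close>
  define P where "P ns v = foldr (scaled_L k) ns v" for ns v
  have P_simps [simp]: "P ns 0 = 0" "P ns (u + v) = P ns u + P ns v"
    "P ns (scale r v) = scale r (P ns v)" for ns u v r
    by (induction ns) (simp_all add: P_def)
  have P_S: "P ns a \<in> ?S" if "a \<in> ?S" for ns a
    by (induction ns) (simp_all add: P_def that scaled_L_closed[OF k(1)])
  let ?W = "{v. \<forall>ns. \<pi> (P ns v) = 0}"
  have "virasoro_submodule ?W"
    unfolding virasoro_submodule_def
  proof (intro conjI allI ballI)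
    show "subspace ?W" by (rule subspaceI) auto
    fix n w assume w: "w \<in> ?W"
    have "\<pi> (P ns (mode omega (n + 1) w)) = 0" for ns
    proof -
      have "of_int k * \<pi> (P ns (mode omega (n + 1) w)) = \<pi> (P ns (scaled_L k n w))"
        unfolding scaled_L_def by simp
      also have "\<dots> = \<pi> (P (ns @ [n]) w)" by (simp add: P_def)
      also have "\<dots> = 0" using w by simp
      finally show ?thesis using k(2) by simp
    qed
    then show "mode omega (n + 1) w \<in> ?W" by simp
  qed
  moreover have "vac \<notin> ?W" using \<pi>(1) by (auto simp: P_def intro!: exI[of _ "[]"])
  ultimately have W: "?W = {0}" using irreducible by (auto simp: irreducible_module_def)
  have linear: "Vector_Spaces.linear scale (*) (\<lambda>v. \<pi> (P ns v))" for ns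
    by unfold_locales (simp_all add: algebra_simps)
  show ?thesis
  proof (rule that[of "range (\<lambda>ns v. \<pi> (P ns v))"])
    show "v = 0" if "\<And>\<phi>. \<phi> \<in> range (\<lambda>ns v. \<pi> (P ns v)) \<Longrightarrow> \<phi> v = 0" for v
    proof -
      have "v \<in> ?W" using that by blast
      then show ?thesis unfolding W by simp
    qed
  qed (use linear P_S \<pi>_Ints in auto)
qed

text \<open>Over the complex numbers \<open>k\<close> can be divided out, so the span is stable
  under the unscaled operators as well. It contains \<open>vac\<close>, and irreducibility leaves
  only the whole space.\<close>

lemma span_monomials:
  assumes k: "of_int k ^ 2 * c / 2 \<in> \<int>" "k \<noteq> 0"
  shows "span (monomials k) = UNIV"
proof -
  have "virasoro_submodule (span (monomials k))"
    unfolding virasoro_submodule_def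
  proof (intro conjI allI ballI)
    fix n w assume "w \<in> span (monomials k)"
    then have "scaled_L k n w \<in> span (monomials k)"
    proof (rule span_induct)
      show "subspace {w. scaled_L k n w \<in> span (monomials k)}"
        by (rule subspaceI) (auto intro: span_zero span_add span_scale)
    qed (use scaled_L_monomials[OF k(1)] int_span_subset_span in blast)
    then have "scale (1 / of_int k) (scaled_L k n w) \<in> span (monomials k)"
      by (rule span_scale)
    then show "mode omega (n + 1) w \<in> span (monomials k)"
      using k(2) by (simp add: scaled_L_def)
  qed (rule subspace_span)
  moreover have "vac \<in> span (monomials k)" by (intro span_base monomials.vac)
  ultimately show ?thesis
    using irreducible vac_nonzero by (auto simp: irreducible_module_def)
qed

text \<open>The central charge enters only through the integrality of \<open>k ^ 2 * c / 2\<close>.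
  Bases of the separate weight pieces are collected into one basis.\<close>

theorem integral_form_generated:
  assumes k: "of_int k ^ 2 * c / 2 \<in> \<int>" "k \<noteq> 0"
  shows "integral_form (generated_vertex_subring {scale (of_int k) omega})"
proof -
  let ?S = "int_span (monomials k)"
  let ?A = "\<lambda>m::int. weight_space (of_int m) \<inter> ?S"
  obtain \<Phi> where \<Phi>: "\<And>\<phi>. \<phi> \<in> \<Phi> \<Longrightarrow> Vector_Spaces.linear scale (*) \<phi>"
    "\<And>\<phi> a. \<phi> \<in> \<Phi> \<Longrightarrow> a \<in> ?S \<Longrightarrow> \<phi> a \<in> \<int>"
    "\<And>v. (\<And>\<phi>. \<phi> \<in> \<Phi> \<Longrightarrow> \<phi> v = 0) \<Longrightarrow> v = 0"
    using integral_functionals[OF k] by blast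
  have sub: "int_module.subspace (?A m)" for m
    by (intro int_module.subspace_inter int_subspace_if_subspace subspace_weight_space
        int_module.subspace_span)
  have "\<exists>B. independent B \<and> ?A m = int_span B" for m
  proof -
    obtain F where F: "finite F" "weight_space (of_int m) \<subseteq> span F"
      using weight_spaces_finite_dim by blast
    obtain \<Psi> where \<Psi>: "finite \<Psi>" "\<Psi> \<subseteq> \<Phi>"
      "\<And>v \<phi>. v \<in> span F \<Longrightarrow> (\<And>\<psi>. \<psi> \<in> \<Psi> \<Longrightarrow> \<psi> v = 0) \<Longrightarrow> \<phi> \<in> \<Phi> \<Longrightarrow> \<phi> v = 0"
      using finite_subfamily_same_kernel[OF F(1) \<Phi>(1)] by blast
    \<comment> \<open>\<open>integral_basis_exists\<close> asks for a trivial common kernel on the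
      complex span of the piece. That span lies in \<open>span F\<close>, where the finite set
      \<open>\<Psi>\<close> has the same common kernel as \<open>\<Phi>\<close>, namely 0.\<close>
    have "span (?A m) \<subseteq> span F"
      using F(2) by (intro span_minimal) auto
    then have "v = 0" if "v \<in> span (?A m)" "\<And>\<psi>. \<psi> \<in> \<Psi> \<Longrightarrow> \<psi> v = 0" for v
      using that \<Psi>(3) \<Phi>(3) by (metis subsetD)
    then show ?thesis
      unfolding int_span_def
      by (intro integral_basis_exists[OF \<Psi>(1)])
        (use sub \<Psi>(2) \<Phi>(1,2) in \<open>auto simp: int_span_def\<close>)
  qed
  then obtain B where B: "\<And>m. independent (B m)" "\<And>m. ?A m = int_span (B m)" by metis
  have BA: "B m \<subseteq> ?A m" for m
    using B(2) int_module.span_superset by blast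
  have "independent (\<Union>m. B m)"
    using BA by (intro independent_UN_direct_sum[OF grading] subspace_weight_space B(1)) auto
  moreover have S: "?S = int_span (\<Union>m. B m)"
  proof
    show "?S \<subseteq> int_span (\<Union>m. B m)"
    proof
      fix s assume "s \<in> ?S"
      then obtain f where "s = Sum_any f" "\<And>m. f m \<in> ?A m"
        using direct_sum_int_span_monomials[of k]
        by (auto simp: internal_direct_sum_def bij_betw_def)
      moreover have "int_span (B m) \<subseteq> int_span (\<Union>m. B m)" for m
        by (rule int_module.span_mono) auto
      ultimately show "s \<in> int_span (\<Union>m. B m)"
        using B(2) by (force simp: Sum_any.expand_set intro: int_module.span_sum)
    qed
    show "int_span (\<Union>m. B m) \<subseteq> ?S"
      using BA by (intro int_module.span_minimal) auto
  qed
  moreover have "span (\<Union>m. B m) = UNIV"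
  proof -
    have "?S \<subseteq> span (\<Union>m. B m)"
      unfolding S by (rule int_span_subset_span)
    then have "monomials k \<subseteq> span (\<Union>m. B m)"
      using int_module.span_superset by blast
    then have "span (monomials k) \<subseteq> span (\<Union>m. B m)"
      by (rule span_minimal) (rule subspace_span)
    then show ?thesis using span_monomials[OF k] by auto
  qed
  ultimately have "\<exists>B. independent B \<and> span B = UNIV \<and> ?S = int_span B" by blast
  moreover have "vertex_subring ?S"
    using vertex_subring_generated unfolding generated_eq_int_span_monomials[OF k(1), symmetric] .
  ultimately show ?thesis
    unfolding integral_form_def generated_eq_int_span_monomials[OF k(1)]
    using direct_sum_int_span_monomials by blast
qed

end

theorem proposition5p1:
  fixes scale :: "complex \<Rightarrow> 'v::ab_group_add \<Rightarrow> 'v"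
    and mode :: "'v \<Rightarrow> int \<Rightarrow> 'v \<Rightarrow> 'v"
    and vac omega :: 'v
  assumes "simple_virasoro_voa scale mode vac omega (1/2)"
  shows "vertex_operator_algebra.integral_form scale mode vac omega
           (vertex_algebra.generated_vertex_subring mode vac {scale 2 omega})"
proof -
  interpret simple_virasoro_voa scale mode vac omega "1/2" by fact
  \<comment> \<open>For \<open>c = 1/2\<close> and \<open>k = 2\<close> the number
    \<open>k ^ 2 * c / 2\<close> equals 1.\<close>
  show ?thesis using integral_form_generated[of 2] by simp
qed

end
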